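(* There exists an infinite family of Steiner quadruple systems with a cyclic $(n/4+1)$-good sequencing, where $n$ denotes the number of points of the system; that is, for infinitely many positive integers $n$ divisible by $4$ there exists a Steiner quadruple system on $n$ points with a cyclic $(n/4+1)$-good sequencing.
   Context: A Steiner quadruple system on $n$ points is a set $V$ with $|V|=n$ together with a set of $4$-subsets of $V$, called blocks, such that every $3$-subset of $V$ is contained in a unique block. A sequencing of $V$ is a sequence $x_1,\ldots,x_n$ in which every element of $V$ occurs exactly once. The cyclic segments of $x_1,\ldots,x_n$ are its subsequences of consecutive entries together with the sequences $x_a,x_{a+1},\ldots,x_n,x_1,\ldots,x_b$ for $1\leq b<a\leq n$. A sequencing is cyclic $\ell$-good if no cyclic segment of length at most $\ell$ contains all the points of a block. *)

theory Defs
  imports Main "HOL-Library.Sublist"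
begin

definition steiner_quadruple_system :: "'a set \<Rightarrow> 'a set set \<Rightarrow> bool" where
  "steiner_quadruple_system V B \<longleftrightarrow>
     finite V \<and>
     (\<forall>b\<in>B. b \<subseteq> V \<and> card b = 4) \<and>
     (\<forall>T. T \<subseteq> V \<and> card T = 3 \<longrightarrow> (\<exists>!b. b \<in> B \<and> T \<subseteq> b))"

definition sequencing :: "'a set \<Rightarrow> 'a list \<Rightarrow> bool" where
  "sequencing V xs \<longleftrightarrow> distinct xs \<and> set xs = V"

text \<open>
  The list \<open>xs\<close> stands for $x_1, \ldots, x_n$, so
  \<open>drop (a - 1) xs @ take b xs\<close> is $x_a, \ldots, x_n, x_1, \ldots, x_b$.
\<close>

definition cyclic_segments :: "'a list \<Rightarrow> 'a list set" where
  "cyclic_segments xs =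
     {ys. sublist ys xs} \<union>
     {drop (a - 1) xs @ take b xs | a b. 1 \<le> b \<and> b < a \<and> a \<le> length xs}"

definition cyclic_good :: "nat \<Rightarrow> 'a set set \<Rightarrow> 'a list \<Rightarrow> bool" where
  "cyclic_good l B xs \<longleftrightarrow>
     (\<forall>ys \<in> cyclic_segments xs. length ys \<le> l \<longrightarrow> \<not> (\<exists>b\<in>B. b \<subseteq> set ys))"

end

theory Submission
  imports Defs "HOL-Computational_Algebra.Primes" "HOL-Library.FuncSet"
begin

text \<open>
  The orders are the powers of two, and the sequencing of \<open>{..<n}\<close> is simply \<open>0, 1, \<dots>, n - 1\<close>; the
  whole content lies in the choice of the blocks. They come from the classical doubling
  construction: two Steiner quadruple systems on disjoint sets \<open>X\<close> and \<open>Y\<close> of size \<open>v\<close>, together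
  with one-factorizations of the complete graphs on \<open>X\<close> and \<open>Y\<close> over the same colours, give a
  system on \<open>X \<union> Y\<close> whose additional blocks join an edge of \<open>X\<close> to an edge of \<open>Y\<close> of the same colour.

  Let \<open>X\<close> be the even and \<open>Y\<close> the odd numbers below \<open>2 * v\<close>, where \<open>v = 4 * m\<close>. A cyclic window of
  length \<open>2 * m + 1\<close> then meets \<open>X\<close> and \<open>Y\<close> in cyclic windows of \<open>v\<close> points, one of length \<open>m\<close> and the
  other of length \<open>m + 1\<close> (\<open>window_halves\<close>). If no window of length \<open>m + 1 = v div 4 + 1\<close> contains
  a block of the system of order \<open>v\<close>, then no window of length \<open>2 * m + 1 = n div 4 + 1\<close>, where
  \<open>n = 2 * v\<close>, contains a block of one of its two copies. So the required bound reproduces itself,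
  and only the additional blocks need care.

  For them the colours are cyclic differences. If \<open>v\<close> is a power of two, then the edges of cyclic
  length \<open>d < v div 2\<close> form cycles of even length, which split into two perfect matchings; the edges
  of length \<open>v div 2\<close> form one perfect matching (\<open>one_factorization_diff_colour\<close>). The
  colours of \<open>Y\<close> are permuted by \<open>opposite_colour\<close> so that edges of length \<open>d\<close> in \<open>X\<close> are joined
  to edges of length \<open>v div 2 - d\<close> in \<open>Y\<close>, and edges of length \<open>v div 2\<close> to edges of the same length.
  Windows of lengths \<open>l\<close> and \<open>l'\<close> contain only edges of lengths at most \<open>l - 1\<close> and \<open>l' - 1\<close>, and these
  sum to at most \<open>2 * m - 1\<close>, less than \<open>v div 2\<close>. So no additional block fits
  (\<open>doubling_step\<close>). The induction starts at the single block on four points.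
\<close>

section \<open>Doubling Steiner quadruple systems\<close>

text \<open>
  A one-factorization of the complete graph on \<open>V\<close>, encoded as an edge colouring: bijectivity says
  that each vertex sees each colour exactly once, so each colour class is a perfect matching.
\<close>

definition one_factorization :: "'a set \<Rightarrow> 'c set \<Rightarrow> ('a \<Rightarrow> 'a \<Rightarrow> 'c) \<Rightarrow> bool" where
  "one_factorization V C c \<longleftrightarrow>
     (\<forall>a\<in>V. \<forall>b\<in>V. c a b = c b a) \<and> (\<forall>a\<in>V. bij_betw (c a) (V - {a}) C)"

definition cross_blocks ::
  "'a set \<Rightarrow> ('a \<Rightarrow> 'a \<Rightarrow> 'c) \<Rightarrow> 'a set \<Rightarrow> ('a \<Rightarrow> 'a \<Rightarrow> 'c) \<Rightarrow> 'a set set" where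
  "cross_blocks X c Y d =
     {{a, b, y, z} | a b y z. a \<in> X \<and> b \<in> X \<and> a \<noteq> b \<and> y \<in> Y \<and> z \<in> Y \<and> y \<noteq> z \<and> c a b = d y z}"

lemma cross_blocks_swap: "cross_blocks X c Y d = cross_blocks Y d X c"
proof -
  have "cross_blocks X c Y d \<subseteq> cross_blocks Y d X c"
    for X Y :: "'a set" and c d :: "'a \<Rightarrow> 'a \<Rightarrow> 'c"
  proof
    fix b assume "b \<in> cross_blocks X c Y d"
    then obtain p q y z where "p \<in> X" "q \<in> X" "p \<noteq> q" "y \<in> Y" "z \<in> Y" "y \<noteq> z" "c p q = d y z"
      and "b = {p, q, y, z}"
      unfolding cross_blocks_def by blast
    then have "b = {y, z, p, q} \<and> y \<in> Y \<and> z \<in> Y \<and> y \<noteq> z \<and> p \<in> X \<and> q \<in> X \<and> p \<noteq> q \<and> d y z = c p q"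
      by auto
    then show "b \<in> cross_blocks Y d X c"
      unfolding cross_blocks_def by blast
  qed
  then show ?thesis by blast
qed

lemma cross_block_card_Int:
  assumes "X \<inter> Y = {}" "b \<in> cross_blocks X c Y d"
  shows "card (b \<inter> X) = 2"
proof -
  obtain p q y z where *: "p \<in> X" "q \<in> X" "p \<noteq> q" "y \<in> Y" "z \<in> Y" "b = {p, q, y, z}"
    using assms(2) unfolding cross_blocks_def by blast
  then have "b \<inter> X = {p, q}" using assms(1) by auto
  then show ?thesis using * by simp
qed

text \<open>
  A triple inside \<open>X\<close> cannot lie in an additional block, since such a block has only two points
  in \<open>X\<close>, so it is covered by the system on \<open>X\<close> alone.
\<close>

lemma ex1_block_within:
  assumes "X \<inter> Y = {}" "steiner_quadruple_system X A" "\<forall>b\<in>B. b \<subseteq> Y"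
    and T: "T \<subseteq> X" "card T = 3"
  shows "\<exists>!b. b \<in> A \<union> B \<union> cross_blocks X c Y d \<and> T \<subseteq> b"
proof -
  have "T \<noteq> {}" using T by auto
  have "b \<in> A" if "b \<in> A \<union> B \<union> cross_blocks X c Y d" "T \<subseteq> b" for b
  proof -
    have "b \<notin> B" using that assms T \<open>T \<noteq> {}\<close> by blast
    moreover have "b \<notin> cross_blocks X c Y d"
    proof
      assume b: "b \<in> cross_blocks X c Y d"
      then have "card (b \<inter> X) = 2" by (rule cross_block_card_Int[OF assms(1)])
      moreover from this have "card T \<le> card (b \<inter> X)"
        using that T by (intro card_mono) (auto intro: card_ge_0_finite)
      ultimately show False using T by simp
    qed
    ultimately show ?thesis using that by blast
  qed
  moreover have "\<exists>!b. b \<in> A \<and> T \<subseteq> b"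
    using assms(2) T unfolding steiner_quadruple_system_def by blast
  ultimately show ?thesis by blast
qed

text \<open>
  The two points in \<open>X\<close> fix a colour, and \<open>y\<close> has exactly one partner in that colour. The blocks
  of the given systems stay on one side and cannot contain the triple.
\<close>

lemma ex1_block_across:
  assumes disj: "X \<inter> Y = {}" and A: "\<forall>b\<in>A. b \<subseteq> X" and B: "\<forall>b\<in>B. b \<subseteq> Y"
    and c: "one_factorization X C c" and d: "one_factorization Y C d"
    and a: "a \<in> X" "b \<in> X" "a \<noteq> b" and y: "y \<in> Y"
  shows "\<exists>!q. q \<in> A \<union> B \<union> cross_blocks X c Y d \<and> {a, b, y} \<subseteq> q"
proof -
  have "bij_betw (c a) (X - {a}) C"
    using c a unfolding one_factorization_def by blast
  then have "c a b \<in> C"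
    using a by (auto simp: bij_betw_def)
  moreover have bij: "bij_betw (d y) (Y - {y}) C"
    using d y unfolding one_factorization_def by blast
  ultimately have "c a b \<in> d y ` (Y - {y})"
    by (simp add: bij_betw_imp_surj_on)
  then obtain z where z: "z \<in> Y" "z \<noteq> y" "d y z = c a b"
    by force
  have uniq: "z' = z" if "z' \<in> Y" "z' \<noteq> y" "d y z' = c a b" for z'
    by (rule inj_onD[OF bij_betw_imp_inj_on[OF bij]]) (use that z in auto)
  show ?thesis
  proof (rule ex1I[of _ "{a, b, y, z}"])
    have "{a, b, y, z} \<in> cross_blocks X c Y d"
      unfolding cross_blocks_def mem_Collect_eq using a y z
      by (intro exI[of _ a] exI[of _ b] exI[of _ y] exI[of _ z]) simp
    then show "{a, b, y, z} \<in> A \<union> B \<union> cross_blocks X c Y d \<and> {a, b, y} \<subseteq> {a, b, y, z}"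
      by blast
  next
    fix q assume q: "q \<in> A \<union> B \<union> cross_blocks X c Y d \<and> {a, b, y} \<subseteq> q"
    have "y \<notin> X" "a \<notin> Y" using disj a y by auto
    then have "\<not> q \<subseteq> X" "\<not> q \<subseteq> Y" using q by auto
    then have "q \<in> cross_blocks X c Y d" using q A B by auto
    then obtain p r u w where qe: "q = {p, r, u, w}" and
      pr: "p \<in> X" "r \<in> X" "p \<noteq> r" and uw: "u \<in> Y" "w \<in> Y" "u \<noteq> w" and eq: "c p r = d u w"
      unfolding cross_blocks_def by blast
    have "a \<noteq> u" "a \<noteq> w" "b \<noteq> u" "b \<noteq> w" "y \<noteq> p" "y \<noteq> r"
      using disj pr uw a y by auto
    moreover have "a \<in> q" "b \<in> q" "y \<in> q" using q by auto
    ultimately have "a \<in> {p, r}" "b \<in> {p, r}" "y \<in> {u, w}" using qe by auto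
    then have ab: "{p, r} = {a, b}" using a(3) by auto
    then have "c p r = c a b"
      using c a unfolding one_factorization_def by (auto simp: doubleton_eq_iff)
    consider "y = u" | "y = w" using \<open>y \<in> {u, w}\<close> by blast
    then have "{u, w} = {y, z}"
    proof cases
      case 1 then show ?thesis using uniq[of w] uw eq \<open>c p r = c a b\<close> by auto
    next
      case 2
      then have "d y u = d u w" using d uw unfolding one_factorization_def by auto
      then show ?thesis using 2 uniq[of u] uw eq \<open>c p r = c a b\<close> by auto
    qed
    then show "q = {a, b, y, z}" using ab qe by auto
  qed
qed

text \<open>
  Every triple has at least two points on one side; by \<open>cross_blocks_swap\<close> the construction is
  symmetric in \<open>X\<close> and \<open>Y\<close>, so the two lemmas above cover all cases.
\<close>

lemma doubling_construction:
  assumes disj: "X \<inter> Y = {}"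
    and A: "steiner_quadruple_system X A" and B: "steiner_quadruple_system Y B"
    and c: "one_factorization X C c" and d: "one_factorization Y C d"
  shows "steiner_quadruple_system (X \<union> Y) (A \<union> B \<union> cross_blocks X c Y d)"
proof -
  have fin: "finite X" "finite Y"
    and AX: "\<forall>b\<in>A. b \<subseteq> X \<and> card b = 4" and BY: "\<forall>b\<in>B. b \<subseteq> Y \<and> card b = 4"
    using A B unfolding steiner_quadruple_system_def by auto
  have cross: "b \<subseteq> X \<union> Y \<and> card b = 4" if "b \<in> cross_blocks X c Y d" for b
  proof -
    from that obtain p q y z where *: "p \<in> X" "q \<in> X" "p \<noteq> q" "y \<in> Y" "z \<in> Y" "y \<noteq> z"
      "b = {p, q, y, z}"
      unfolding cross_blocks_def by blast
    then have "p \<noteq> y" "p \<noteq> z" "q \<noteq> y" "q \<noteq> z" using disj by auto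
    then show ?thesis using * by auto
  qed
  have disj': "Y \<inter> X = {}" using disj by blast
  have swap: "A \<union> B \<union> cross_blocks X c Y d = B \<union> A \<union> cross_blocks Y d X c"
    using cross_blocks_swap[of X c Y d] by blast
  \<comment> \<open>An opaque name keeps the many case distinctions from unfolding the union.\<close>
  define Q where "Q = A \<union> B \<union> cross_blocks X c Y d"
  have "\<exists>!b. b \<in> Q \<and> T \<subseteq> b" if T: "T \<subseteq> X \<union> Y" "card T = 3" for T
  proof -
    obtain s t u where T3: "T = {s, t, u}" "s \<noteq> t" "t \<noteq> u" "s \<noteq> u"
      using T(2) by (auto simp: card_3_iff)
    have two_X: ?thesis if "T = {a, b, y}" "a \<in> X" "b \<in> X" "a \<noteq> b" "y \<in> Y" for a b y
      using ex1_block_across[OF disj _ _ c d that(2-5), of A B] AX BY that(1) by (simp add: Q_def)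
    have two_Y: ?thesis if "T = {a, b, y}" "a \<in> Y" "b \<in> Y" "a \<noteq> b" "y \<in> X" for a b y
      unfolding Q_def swap
      using ex1_block_across[OF disj' _ _ d c that(2-5), of B A] AX BY that(1) by simp
    have "T \<subseteq> X \<Longrightarrow> ?thesis"
      using ex1_block_within[OF disj A _ _ T(2), of B c d] BY by (simp add: Q_def)
    moreover have "T \<subseteq> Y \<Longrightarrow> ?thesis"
      unfolding Q_def swap using ex1_block_within[OF disj' B _ _ T(2), of A d c] AX by simp
    moreover have "s \<in> X \<or> s \<in> Y" "t \<in> X \<or> t \<in> Y" "u \<in> X \<or> u \<in> Y" using T T3 by auto
    moreover have "T = {s, u, t}" "T = {t, u, s}" using T3 by auto
    ultimately show ?thesis
      using two_X[of s t u] two_X[of s u t] two_X[of t u s]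
        two_Y[of s t u] two_Y[of s u t] two_Y[of t u s] T3
      by (elim disjE) (simp_all)
  qed
  moreover have "\<forall>b\<in>Q. b \<subseteq> X \<union> Y \<and> card b = 4"
    unfolding Q_def using AX BY cross by blast
  ultimately have "steiner_quadruple_system (X \<union> Y) Q"
    using fin unfolding steiner_quadruple_system_def by simp
  then show ?thesis unfolding Q_def .
qed

lemma steiner_quadruple_system_image:
  assumes S: "steiner_quadruple_system V B" and f: "inj_on f V"
  shows "steiner_quadruple_system (f ` V) ((`) f ` B)"
proof -
  have BV: "\<forall>b\<in>B. b \<subseteq> V \<and> card b = 4" and fin: "finite V"
    using S unfolding steiner_quadruple_system_def by auto
  have "\<exists>!b. b \<in> (`) f ` B \<and> T \<subseteq> b" if T: "T \<subseteq> f ` V" "card T = 3" for T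
  proof -
    obtain U where U: "U \<subseteq> V" "T = f ` U" using T(1) by (meson subset_imageE)
    then have "card U = 3" using T(2) f card_image inj_on_subset by metis
    then have ex: "\<exists>!b. b \<in> B \<and> U \<subseteq> b"
      using S U unfolding steiner_quadruple_system_def by blast
    have sub: "T \<subseteq> f ` b \<longleftrightarrow> U \<subseteq> b" if "b \<in> B" for b
    proof
      assume *: "T \<subseteq> f ` b"
      have "b \<subseteq> V" using BV that by blast
      show "U \<subseteq> b"
      proof
        fix x assume "x \<in> U"
        then have "x \<in> V" "f x \<in> f ` b" using * U by auto
        then show "x \<in> b" using inj_on_image_mem_iff[OF f _ \<open>b \<subseteq> V\<close>] by simp
      qed
    qed (use U in auto)
    obtain b where b: "b \<in> B" "U \<subseteq> b" "\<And>b'. b' \<in> B \<Longrightarrow> U \<subseteq> b' \<Longrightarrow> b' = b"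
      using ex by blast
    show ?thesis
    proof (rule ex1I[of _ "f ` b"])
      show "f ` b \<in> (`) f ` B \<and> T \<subseteq> f ` b"
        using b(1,2) sub[OF b(1)] by blast
    next
      fix q assume "q \<in> (`) f ` B \<and> T \<subseteq> q"
      then obtain b' where b': "b' \<in> B" "q = f ` b'" "T \<subseteq> f ` b'" by blast
      then have "b' = b" using b(3) sub by blast
      then show "q = f ` b" using b' by simp
    qed
  qed
  moreover have "card (f ` b) = 4" if "b \<in> B" for b
    using BV that f card_image inj_on_subset by metis
  ultimately show ?thesis
    using fin BV unfolding steiner_quadruple_system_def by (simp add: image_mono)
qed

lemma one_factorization_comap:
  assumes "one_factorization V C c" and g: "bij_betw g W V"
  shows "one_factorization W C (\<lambda>a b. c (g a) (g b))"
proof -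
  have gV: "g a \<in> V" if "a \<in> W" for a using g that by (auto dest: bij_betwE)
  have "bij_betw (c (g a) \<circ> g) (W - {a}) C" if a: "a \<in> W" for a
  proof (rule bij_betw_trans)
    show "bij_betw g (W - {a}) (V - {g a})"
      using g gV[OF a] a by (intro bij_betw_DiffI) auto
    show "bij_betw (c (g a)) (V - {g a}) C"
      using assms(1) gV[OF a] unfolding one_factorization_def by blast
  qed
  then show ?thesis
    using assms(1) gV unfolding one_factorization_def by (simp add: comp_def)
qed

lemma one_factorization_recolour:
  assumes "one_factorization V C c" and "bij_betw p C D"
  shows "one_factorization V D (\<lambda>a b. p (c a b))"
proof -
  have "bij_betw (p \<circ> c a) (V - {a}) D" if "a \<in> V" for a
    using assms that unfolding one_factorization_def by (blast intro: bij_betw_trans)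
  then show ?thesis
    using assms(1) unfolding one_factorization_def by (simp add: comp_def)
qed

section \<open>A one-factorization by cyclic differences\<close>

text \<open>
  The colour of an edge is its difference modulo \<open>v\<close>, read in a direction that must be the same from
  both ends. Let \<open>v\<close> be a power of two and let \<open>2 ^ e\<close> be the largest power of two dividing the
  difference of two distinct ends below \<open>v\<close>, which is its gcd with \<open>v\<close>. The ends differ in bit \<open>e\<close>, and the edge is directed
  from the end where this bit is \<open>0\<close> to the end where it is \<open>1\<close>. Writing \<open>2 ^ e\<close> as a gcd makes
  it visibly invariant under reduction modulo \<open>v\<close>.
\<close>

definition diff_colour :: "nat \<Rightarrow> nat \<Rightarrow> nat \<Rightarrow> int" where
  "diff_colour v a b =
     (if even (int a div gcd (int b - int a) (int v)) then int b - int a else int a - int b) mod int v"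

text \<open>
  A proper divisor \<open>g\<close> of \<open>2 ^ k\<close> can be doubled and still divide \<open>2 ^ k\<close>, so if \<open>t div g\<close> were even
  as well, then the gcd would not be the greatest common divisor.
\<close>

lemma odd_div_gcd_power2:
  assumes "\<not> (2 ^ k :: int) dvd t"
  shows "odd (t div gcd t (2 ^ k))"
proof
  define g where "g = gcd t (2 ^ k)"
  assume "even (t div gcd t (2 ^ k))"
  then have "2 * g dvd t"
    unfolding g_def by (metis dvd_div_mult_self gcd_dvd1 mult_dvd_mono dvd_refl)
  have "g dvd 2 ^ k" "g \<ge> 0" unfolding g_def by simp_all
  then obtain e where e: "e \<le> k" "g = 2 ^ e"
    using divides_primepow[of "2 :: int" g k] by auto
  have "e \<noteq> k" using assms e g_def gcd_dvd1 by metis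
  then have "2 ^ Suc e dvd (2 ^ k :: int)" using e(1) by (intro le_imp_power_dvd) simp
  then have "2 * g dvd 2 ^ k" using e by simp
  with \<open>2 * g dvd t\<close> have "2 * g dvd g" unfolding g_def by (rule gcd_greatest)
  then show False using e by (auto dest: zdvd_imp_le)
qed

text \<open>
  Adding \<open>t\<close> flips the bit of \<open>x\<close> at the position of the lowest set bit of \<open>t\<close>. This is
  what makes the cycles of the step \<open>t\<close> bipartite.
\<close>

lemma even_div_gcd_power2_flip:
  assumes "\<not> (2 ^ k :: int) dvd t"
  shows "even ((x + t) div gcd t (2 ^ k)) \<longleftrightarrow> odd (x div gcd t (2 ^ k))"
  using odd_div_gcd_power2[OF assms] by (simp add: div_plus_div_distrib_dvd_right)

lemma diff_colour_cases:
  "diff_colour v a b = (int b - int a) mod int v \<or> diff_colour v a b = (int a - int b) mod int v"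
  unfolding diff_colour_def by simp

lemma not_dvd_diff:
  assumes "a < v" "b < v" "a \<noteq> b"
  shows "\<not> int v dvd int b - int a"
  using assms zdvd_imp_le[of "int v" "\<bar>int b - int a\<bar>"] by auto

lemma gcd_minus_swap: "gcd (x - y) v = gcd (y - x) (v :: int)"
  by (metis gcd_neg1_int minus_diff_eq)

lemma diff_colour_commute:
  assumes "a < 2 ^ k" "b < 2 ^ k"
  shows "diff_colour (2 ^ k) a b = diff_colour (2 ^ k) b a"
proof (cases "a = b")
  case False
  then have "\<not> 2 ^ k dvd int b - int a" using not_dvd_diff[OF assms] by simp
  from even_div_gcd_power2_flip[OF this, of "int a"]
  show ?thesis
    unfolding diff_colour_def by (auto simp: gcd_minus_swap[of "int a" "int b"])
qed simp

text \<open>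
  The partner of \<open>a\<close> in colour \<open>t\<close> is \<open>a + t\<close> or \<open>a - t\<close>, according to the bit of \<open>a\<close> at the lowest
  set bit of \<open>t\<close>. That position depends only on \<open>\<plusminus> t\<close> modulo \<open>v\<close>, hence it can be read off
  the edge as well as off its colour, and the two maps are inverse to each other.
\<close>

lemma one_factorization_diff_colour:
  "one_factorization {..<2 ^ k} {1..<2 ^ k} (diff_colour (2 ^ k))"
proof -
  define v :: nat where "v = 2 ^ k"
  have v: "v > 0" "int v = 2 ^ k" by (simp_all add: v_def)
  have "bij_betw (diff_colour v a) ({..<v} - {a}) {1..<int v}" if a: "a < v" for a
  proof -
    define even_side where "even_side t \<longleftrightarrow> even (int a div gcd t (int v))" for t
    define partner where
      "partner t = nat ((if even_side t then int a + t else int a - t) mod int v)" for t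
    have int_partner:
      "int (partner t) = (if even_side t then int a + t else int a - t) mod int v" for t
      unfolding partner_def using v(1) by simp
    have side_cong: "even_side t = even_side u" if "t mod int v = u mod int v" for t u
    proof -
      have "gcd x (int v) = gcd (x mod int v) (int v)" for x using v(1) by simp
      from this[of t] this[of u] show ?thesis unfolding even_side_def that by simp
    qed
    have side_minus: "even_side (- t) = even_side t" for t
      unfolding even_side_def by simp
    have colour: "diff_colour v a b =
        (if even_side (int b - int a) then int b - int a else int a - int b) mod int v" for b
      unfolding diff_colour_def even_side_def by simp
    have side_colour: "even_side (diff_colour v a b) = even_side (int b - int a)" for b
    proof -
      have "even_side (x mod int v) = even_side x" for x by (rule side_cong) simp
      moreover have "even_side (int a - int b) = even_side (int b - int a)"
        using side_minus[of "int b - int a"] by simp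
      ultimately show ?thesis unfolding colour by simp
    qed
    show ?thesis
    proof (rule bij_betwI[where g = partner])
      show "diff_colour v a \<in> {..<v} - {a} \<rightarrow> {1..<int v}"
      proof
        fix b assume "b \<in> {..<v} - {a}"
        then have "\<not> int v dvd int b - int a" "\<not> int v dvd int a - int b"
          using a not_dvd_diff[of a v b] not_dvd_diff[of b v a] by auto
        then have "diff_colour v a b \<noteq> 0"
          using diff_colour_cases[of v a b] by (auto simp: mod_eq_0_iff_dvd)
        moreover have "diff_colour v a b \<ge> 0" "diff_colour v a b < int v"
          using v unfolding diff_colour_def by simp_all
        ultimately show "diff_colour v a b \<in> {1..<int v}" by simp
      qed
      show "partner \<in> {1..<int v} \<rightarrow> {..<v} - {a}"
      proof
        fix t assume t: "t \<in> {1..<int v}"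
        have "partner t < v" unfolding partner_def using v by (simp add: nat_less_iff)
        moreover have "partner t \<noteq> a"
        proof
          assume "partner t = a"
          then have "(if even_side t then int a + t else int a - t) mod int v = int a"
            using int_partner[of t] by simp
          then have "(if even_side t then int a + t else int a - t) mod int v = int a mod int v"
            using a by simp
          then have "int v dvd t"
            by (auto simp: mod_eq_dvd_iff split: if_splits)
          then show False using t zdvd_imp_le by fastforce
        qed
        ultimately show "partner t \<in> {..<v} - {a}" by simp
      qed
      show "partner (diff_colour v a b) = b" if "b \<in> {..<v} - {a}" for b
      proof -
        have "(int a + (int b - int a) mod int v) mod int v = int b"
          "(int a - (int a - int b) mod int v) mod int v = int b"
          using that by (simp_all add: mod_simps)
        then show ?thesis
          unfolding partner_def side_colour by (simp add: colour)
      qed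
      show "diff_colour v a (partner t) = t" if t: "t \<in> {1..<int v}" for t
      proof -
        define u where "u = (if even_side t then t else - t)"
        have p: "int (partner t) = (int a + u) mod int v"
          unfolding int_partner u_def by simp
        then have m: "(int (partner t) - int a) mod int v = u mod int v"
          "(int a - int (partner t)) mod int v = (- u) mod int v"
          by (simp_all add: mod_simps)
        have "even_side (int (partner t) - int a) = even_side u"
          by (rule side_cong) (rule m)
        also have "\<dots> = even_side t" unfolding u_def using side_minus by simp
        finally show ?thesis unfolding colour using m t by (simp add: u_def split: if_splits)
      qed
    qed
  qed
  then show ?thesis
    unfolding one_factorization_def using diff_colour_commute[of _ k] by (simp add: v_def)
qed

text \<open>
  With \<open>2 * h = v\<close> this is translation by \<open>h\<close> modulo \<open>v\<close>, which turns cyclic length \<open>d\<close> into \<open>h - d\<close>,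
  except that \<open>h\<close> is fixed because its translate \<open>0\<close> is not a colour.
\<close>

definition opposite_colour :: "int \<Rightarrow> int \<Rightarrow> int" where
  "opposite_colour h t = (if t < h then t + h else if h < t then t - h else h)"

lemma bij_opposite_colour: "bij_betw (opposite_colour h) {1..<2 * h} {1..<2 * h}"
  by (rule bij_betwI[where g = "opposite_colour h"]) (auto simp: opposite_colour_def)

section \<open>Cyclic windows\<close>

definition window :: "nat \<Rightarrow> nat \<Rightarrow> nat \<Rightarrow> nat set" where
  "window n s l = (\<lambda>j. (s + j) mod n) ` {..<l}"

lemma window_mono: "l \<le> m \<Longrightarrow> window n s l \<subseteq> window n s m"
  unfolding window_def by auto

lemma card_window_le: "card (window n s l) \<le> l"
  unfolding window_def using card_image_le[of "{..<l}"] by simp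

lemma finite_window: "finite (window n s l)"
  unfolding window_def by simp

text \<open>
  Two points of a window of length \<open>l\<close> have a difference of absolute value less than \<open>l\<close>, in whichever
  direction the edge is read.
\<close>

lemma diff_colour_window:
  assumes "a \<in> window v s l" "b \<in> window v s l" "l \<le> v"
  shows "diff_colour v a b < int l \<or> int v - int l < diff_colour v a b"
proof -
  have small: "x mod int v < int l \<or> int v - int l < x mod int v" if "\<bar>x\<bar> < int l" for x
  proof (cases "x \<ge> 0")
    case True
    then show ?thesis using that assms(3) by simp
  next
    case False
    then have "(x + int v) mod int v = x + int v"
      using that assms(3) by (intro mod_pos_pos_trivial) auto
    then have "x mod int v = x + int v" by simp
    then show ?thesis using that by linarith
  qed
  obtain i j where ij: "i < l" "j < l" "a = (s + i) mod v" "b = (s + j) mod v"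
    using assms(1,2) unfolding window_def by auto
  then have "(int b - int a) mod int v = (int j - int i) mod int v"
    "(int a - int b) mod int v = (int i - int j) mod int v"
    by (simp_all add: zmod_int mod_simps)
  then show ?thesis
    using diff_colour_cases[of v a b] small[of "int j - int i"] small[of "int i - int j"] ij by auto
qed

text \<open>
  Consecutive positions alternate in parity, so the even and the odd members of a window of odd length
  form, after halving, two windows whose lengths differ by one; the parity of \<open>s\<close> decides which of
  them is longer.
\<close>

lemma window_halves:
  obtains r r' l l' where "l \<le> m + 1" "l' \<le> m + 1" "l + l' = 2 * m + 1"
    and "\<And>i. 2 * i \<in> window (2 * v) s (2 * m + 1) \<Longrightarrow> i \<in> window v r l"
    and "\<And>i. 2 * i + 1 \<in> window (2 * v) s (2 * m + 1) \<Longrightarrow> i \<in> window v r' l'"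
proof -
  define W where "W = window (2 * v) s (2 * m + 1)"
  have W: "\<exists>j < 2 * m + 1. even (s + j) = even x \<and> x div 2 = ((s + j) div 2) mod v" if x: "x \<in> W" for x
  proof -
    obtain j where j: "j < 2 * m + 1" "x = (s + j) mod (2 * v)"
      using x unfolding W_def window_def by auto
    \<comment> \<open>Reducing modulo \<open>2 * v\<close> keeps the parity and reduces the half modulo \<open>v\<close>.\<close>
    then have "x = 2 * (((s + j) div 2) mod v) + (s + j) mod 2" by (simp only: mod_mult2_eq)
    then have "even (s + j) = even x \<and> x div 2 = ((s + j) div 2) mod v" by auto
    then show ?thesis using j by blast
  qed
  show ?thesis
  proof (cases "even s")
    case True
    then obtain q where q: "s = 2 * q" by blast
    show ?thesis
    proof (rule that[of "m + 1" m q q])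
      fix i
      show "i \<in> window v q (m + 1)" if i: "2 * i \<in> window (2 * v) s (2 * m + 1)"
      proof -
        obtain j where "j < 2 * m + 1" "even (s + j)" "i = ((s + j) div 2) mod v"
          using W[of "2 * i"] i unfolding W_def by auto
        moreover from this q obtain p where "j = 2 * p" by auto
        ultimately show ?thesis unfolding window_def using q by (auto intro!: image_eqI[of _ _ p])
      qed
      show "i \<in> window v q m" if i: "2 * i + 1 \<in> window (2 * v) s (2 * m + 1)"
      proof -
        obtain j where "j < 2 * m + 1" "odd (s + j)" "i = ((s + j) div 2) mod v"
          using W[of "2 * i + 1"] i unfolding W_def by auto
        moreover from this q obtain p where "j = 2 * p + 1" by (auto elim!: oddE)
        ultimately show ?thesis unfolding window_def using q by (auto intro!: image_eqI[of _ _ p])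
      qed
    qed simp_all
  next
    case False
    then obtain q where q: "s = 2 * q + 1" by (auto elim: oddE)
    show ?thesis
    proof (rule that[of m "m + 1" "q + 1" q])
      fix i
      show "i \<in> window v (q + 1) m" if i: "2 * i \<in> window (2 * v) s (2 * m + 1)"
      proof -
        obtain j where "j < 2 * m + 1" "even (s + j)" "i = ((s + j) div 2) mod v"
          using W[of "2 * i"] i unfolding W_def by auto
        moreover from this q obtain p where "j = 2 * p + 1" by (auto elim!: oddE)
        ultimately show ?thesis unfolding window_def using q by (auto intro!: image_eqI[of _ _ p])
      qed
      show "i \<in> window v q (m + 1)" if i: "2 * i + 1 \<in> window (2 * v) s (2 * m + 1)"
      proof -
        obtain j where "j < 2 * m + 1" "odd (s + j)" "i = ((s + j) div 2) mod v"
          using W[of "2 * i + 1"] i unfolding W_def by auto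
        moreover from this q obtain p where "j = 2 * p" by auto
        ultimately show ?thesis unfolding window_def using q by (auto intro!: image_eqI[of _ _ p])
      qed
    qed simp_all
  qed
qed

lemma cyclic_segment_upt_subset_window:
  assumes "ys \<in> cyclic_segments [0..<n]" "length ys \<le> l"
  shows "\<exists>s. set ys \<subseteq> window n s l"
proof -
  consider "sublist ys [0..<n]" |
    a b where "ys = drop (a - 1) [0..<n] @ take b [0..<n]" "1 \<le> b" "b < a" "a \<le> n"
    using assms(1) unfolding cyclic_segments_def by auto
  then show ?thesis
  proof cases
    case 1
    then obtain ps qs where split: "[0..<n] = ps @ ys @ qs" unfolding sublist_def by blast
    have "set ys \<subseteq> window n (length ps) l"
    proof
      fix y assume "y \<in> set ys"
      then obtain j where j: "j < length ys" "ys ! j = y" by (auto simp: in_set_conv_nth)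
      have len: "n = length ps + length ys + length qs" using arg_cong[OF split, of length] by simp
      then have "y = [0..<n] ! (length ps + j)" unfolding split using j by (simp add: nth_append)
      also have "\<dots> = length ps + j" using len j by simp
      finally have "y = (length ps + j) mod n" using len j by simp
      then show "y \<in> window n (length ps) l" unfolding window_def using j assms(2) by auto
    qed
    then show ?thesis by blast
  next
    case (2 a b)
    then have ys: "set ys = {a - 1..<n} \<union> {..<b}" and len: "length ys = n - (a - 1) + b"
      by (auto simp: take_upt atLeast0LessThan min_def)
    have "set ys \<subseteq> window n (a - 1) l"
    proof
      fix y assume "y \<in> set ys"
      then consider "a - 1 \<le> y" "y < n" | "y < b" unfolding ys by auto
      then show "y \<in> window n (a - 1) l"
      proof cases
        case 1
        then have "y = (a - 1 + (y - (a - 1))) mod n" "y - (a - 1) < l"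
          using len assms(2) 2 by auto
        then show ?thesis unfolding window_def by blast
      next
        case 2
        have "a - 1 + (n - (a - 1) + y) = y + n" using \<open>a \<le> n\<close> by simp
        then have "(a - 1 + (n - (a - 1) + y)) mod n = y"
          using 2 \<open>b < a\<close> \<open>a \<le> n\<close> by simp
        moreover have "n - (a - 1) + y < l" using len assms(2) 2 by simp
        ultimately show ?thesis unfolding window_def by force
      qed
    qed
    then show ?thesis by blast
  qed
qed

section \<open>The family on powers of two\<close>

text \<open>
  Blocks inherited from \<open>A\<close> would give a block of \<open>A\<close> in a window of length at most \<open>m + 1\<close>. A block
  across would join two edges whose cyclic lengths add up to \<open>2 * m\<close> or are both equal to \<open>2 * m\<close>,
  while the two windows allow lengths adding up to at most \<open>l + l' - 2 = 2 * m - 1\<close>.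
\<close>

lemma doubling_step:
  assumes v: "v = 2 ^ k" "v = 4 * m"
    and A: "steiner_quadruple_system {..<v} A"
    and good: "\<forall>b\<in>A. \<forall>s. \<not> b \<subseteq> window v s (m + 1)"
  shows "\<exists>B. steiner_quadruple_system {..<2 * v} B \<and>
           (\<forall>b\<in>B. \<forall>s. \<not> b \<subseteq> window (2 * v) s (2 * m + 1))"
proof -
  define dbl dbl1 :: "nat \<Rightarrow> nat" where "dbl i = 2 * i" and "dbl1 i = 2 * i + 1" for i
  define X Y where "X = dbl ` {..<v}" and "Y = dbl1 ` {..<v}"
  define c where "c a b = diff_colour v (a div 2) (b div 2)" for a b
  define d where "d a b = opposite_colour (2 * int m) (c a b)" for a b
  define B where "B = (`) dbl ` A \<union> (`) dbl1 ` A \<union> cross_blocks X c Y d"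
  have m: "m > 0" using v by (metis gr0I mult_0_right power_not_zero zero_neq_numeral)
  have fact: "one_factorization {..<v} {1..<2 * (2 * int m)} (diff_colour v)"
  proof -
    have "int (2 ^ k) = int (4 * m)" using v by (simp only:)
    then have "(2 :: int) ^ k = 2 * (2 * int m)" by simp
    then show ?thesis using one_factorization_diff_colour[of k] unfolding v(1) by (simp only:)
  qed
  have div2: "bij_betw (\<lambda>x. x div 2) X {..<v}" "bij_betw (\<lambda>x. x div 2) Y {..<v}"
    unfolding X_def Y_def dbl_def dbl1_def
    by (auto simp: bij_betw_def inj_on_def image_image)
  have c: "one_factorization X {1..<2 * (2 * int m)} c"
    unfolding c_def by (rule one_factorization_comap[OF fact div2(1)])
  have d: "one_factorization Y {1..<2 * (2 * int m)} d"
    unfolding d_def c_def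
    by (rule one_factorization_recolour[OF one_factorization_comap[OF fact div2(2)] bij_opposite_colour])
  have "{..<2 * v} = X \<union> Y"
  proof -
    have "x \<in> X \<union> Y" if "x < 2 * v" for x
      using that unfolding X_def Y_def dbl_def dbl1_def
      by (cases "even x") (auto elim!: evenE oddE)
    then show ?thesis unfolding X_def Y_def dbl_def dbl1_def by auto
  qed
  moreover have "X \<inter> Y = {}" unfolding X_def Y_def dbl_def dbl1_def by auto presburger
  moreover have "steiner_quadruple_system X ((`) dbl ` A)"
    unfolding X_def by (rule steiner_quadruple_system_image[OF A]) (simp add: inj_on_def dbl_def)
  moreover have "steiner_quadruple_system Y ((`) dbl1 ` A)"
    unfolding Y_def by (rule steiner_quadruple_system_image[OF A]) (simp add: inj_on_def dbl1_def)
  ultimately have "steiner_quadruple_system {..<2 * v} B"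
    unfolding B_def using doubling_construction[OF _ _ _ c d] by metis
  moreover have "\<not> b \<subseteq> window (2 * v) s (2 * m + 1)" if "b \<in> B" for b s
  proof
    assume bW: "b \<subseteq> window (2 * v) s (2 * m + 1)"
    obtain r r' l l' where l: "l \<le> m + 1" "l' \<le> m + 1" "l + l' = 2 * m + 1"
      and ev: "\<And>i. 2 * i \<in> window (2 * v) s (2 * m + 1) \<Longrightarrow> i \<in> window v r l"
      and od: "\<And>i. 2 * i + 1 \<in> window (2 * v) s (2 * m + 1) \<Longrightarrow> i \<in> window v r' l'"
      using window_halves[of m v s] by metis
    consider b0 where "b0 \<in> A" "b = dbl ` b0" | b0 where "b0 \<in> A" "b = dbl1 ` b0"
      | "b \<in> cross_blocks X c Y d"
      using \<open>b \<in> B\<close> unfolding B_def by blast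
    then show False
    proof cases
      case 1
      then have "b0 \<subseteq> window v r l" using ev bW unfolding dbl_def by auto
      then show False using good 1(1) window_mono[OF l(1)] by blast
    next
      case 2
      then have "b0 \<subseteq> window v r' l'" using od bW unfolding dbl1_def by auto
      then show False using good 2(1) window_mono[OF l(2)] by blast
    next
      case 3
      then obtain p q y z where pq: "p \<in> X" "q \<in> X" and yz: "y \<in> Y" "z \<in> Y"
        and eq: "c p q = d y z" and b: "b = {p, q, y, z}"
        unfolding cross_blocks_def by blast
      have "p div 2 \<in> window v r l" "q div 2 \<in> window v r l"
        using pq ev bW b unfolding X_def dbl_def by auto
      from diff_colour_window[OF this]
      have near_X: "c p q < int l \<or> int v - int l < c p q" unfolding c_def using l v m by simp
      have "y div 2 \<in> window v r' l'" "z div 2 \<in> window v r' l'"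
        using yz od bW b unfolding Y_def dbl1_def by auto
      from diff_colour_window[OF this]
      have near_Y: "c y z < int l' \<or> int v - int l' < c y z" unfolding c_def using l v m by simp
      have "0 \<le> c y z" "c y z < int v"
        unfolding c_def diff_colour_def using v(2) m by simp_all
      then show False
        using near_X near_Y eq l v(2) m unfolding d_def opposite_colour_def
        by (auto split: if_splits)
    qed
  qed
  ultimately show ?thesis by blast
qed

lemma ex_good_quadruple_system:
  "\<exists>B. steiner_quadruple_system {..<2 ^ (k + 2)} B \<and>
     (\<forall>b\<in>B. \<forall>s. \<not> b \<subseteq> window (2 ^ (k + 2)) s (2 ^ k + 1))"
proof (induction k)
  case 0
  have "steiner_quadruple_system {..<4} {{..<4::nat}}"
    unfolding steiner_quadruple_system_def by auto
  moreover have "\<not> {..<4} \<subseteq> window 4 s (1 + 1)" for s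
    using card_mono[OF finite_window, of "{..<4}" 4 s "1 + 1"] card_window_le[of 4 s "1 + 1"] by auto
  moreover have "2 ^ (0 + 2) = (4 :: nat)" "2 ^ 0 = (1 :: nat)" by simp_all
  ultimately show ?case by (metis singletonD)
next
  case (Suc k)
  then obtain A where "steiner_quadruple_system {..<2 ^ (k + 2)} A"
    "\<forall>b\<in>A. \<forall>s. \<not> b \<subseteq> window (2 ^ (k + 2)) s (2 ^ k + 1)" by blast
  from doubling_step[OF refl _ this] show ?case by simp
qed

theorem corollary15:
  "infinite {n::nat. 0 < n \<and> 4 dvd n \<and>
     (\<exists>(V :: nat set) B xs.
        steiner_quadruple_system V B \<and> card V = n \<and>
        sequencing V xs \<and> cyclic_good (n div 4 + 1) B xs)}" (is "infinite ?N")
proof -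
  have "2 ^ (k + 2) \<in> ?N" for k
  proof -
    obtain B :: "nat set set" where B: "steiner_quadruple_system {..<2 ^ (k + 2)} B"
      "\<forall>b\<in>B. \<forall>s. \<not> b \<subseteq> window (2 ^ (k + 2)) s (2 ^ k + 1)"
      using ex_good_quadruple_system by blast
    have "cyclic_good (2 ^ (k + 2) div 4 + 1) B [0..<2 ^ (k + 2)]"
      unfolding cyclic_good_def
      using cyclic_segment_upt_subset_window[of _ "2 ^ (k + 2)" "2 ^ k + 1"] B(2)
      by (auto simp del: upt_Suc) (meson subset_trans)
    moreover have "sequencing {..<2 ^ (k + 2)} [0..<2 ^ (k + 2)]"
      unfolding sequencing_def by (simp add: atLeast0LessThan)
    ultimately have "\<exists>(V :: nat set) B xs. steiner_quadruple_system V B \<and> card V = 2 ^ (k + 2) \<and>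
        sequencing V xs \<and> cyclic_good (2 ^ (k + 2) div 4 + 1) B xs"
      using B(1) card_lessThan by blast
    then show ?thesis by simp
  qed
  then have "range (\<lambda>k. 2 ^ (k + 2)) \<subseteq> ?N" by blast
  moreover have "infinite (range (\<lambda>k. 2 ^ (k + 2) :: nat))"
    by (auto dest!: finite_imageD simp: inj_on_def)
  ultimately show ?thesis using infinite_super by blast
qed

end
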